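(* Let $M$ be a compact $C^\infty$ Riemannian manifold and let $\alpha:\mathcal{H}\to\mathrm{Diff}^\infty(M)$ be a $C^\infty$ action of the discrete Heisenberg group $\mathcal{H}$. Let $h=\alpha(\mathcal{C})$. Then the topological entropy of $h$ is zero: $h_{\mathrm{top}}(h)=0$.
   Context: The discrete Heisenberg group $\mathcal{H}$ is generated by $A,B,\mathcal{C}$ with relations $A\mathcal{C}=\mathcal{C}A$, $B\mathcal{C}=\mathcal{C}B$, $AB=BA\mathcal{C}$. An action is a group homomorphism into a diffeomorphism group. *)

theory Defs
  imports "HOL-Analysis.Analysis" "HOL-Algebra.Group"
begin

section \<open>Smooth maps between open subsets of vector spaces\<close>

text \<open>
  For an open set \<open>S\<close> in a finite-dimensional space, \<open>Ck_on k S f\<close> says that \<open>f\<close> is of class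
  \<open>C\<close>-\<open>k\<close> on \<open>S\<close>: all iterated directional derivatives up to order \<open>k\<close> exist (as values of Frechet
  derivatives) and are continuous.
\<close>

primrec Ck_on :: "nat \<Rightarrow> 'a::real_normed_vector set \<Rightarrow> ('a \<Rightarrow> 'b::real_normed_vector) \<Rightarrow> bool" where
  "Ck_on 0 S f \<longleftrightarrow> continuous_on S f"
| "Ck_on (Suc k) S f \<longleftrightarrow> (\<forall>x\<in>S. f differentiable (at x)) \<and>
     (\<forall>v. Ck_on k S (\<lambda>x. frechet_derivative f (at x) v))"

definition smooth_on :: "'a::real_normed_vector set \<Rightarrow> ('a \<Rightarrow> 'b::real_normed_vector) \<Rightarrow> bool" where
  "smooth_on S f \<longleftrightarrow> (\<forall>k. Ck_on k S f)"


section \<open>Smooth manifolds, diffeomorphisms and Riemannian metrics\<close>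

text \<open>
  The underlying space of a manifold is a whole Hausdorff type \<open>'m\<close>.  The model space \<open>'e\<close> is a
  finite-dimensional Euclidean vector space; it is a type of class \<^class>\<open>real_inner\<close> with a finite
  spanning set instead of class \<^class>\<open>euclidean_space\<close> because the latter excludes dimension 0.
  Manifolds have no boundary and need not be connected.
\<close>

type_synonym ('m, 'e) chart = "'m set \<times> ('m \<Rightarrow> 'e)"

definition is_chart :: "('m::topological_space, 'e::topological_space) chart \<Rightarrow> bool" where
  "is_chart = (\<lambda>(U, \<phi>). open U \<and> open (\<phi> ` U) \<and> (\<exists>\<psi>. homeomorphism U (\<phi> ` U) \<phi> \<psi>))"

text \<open>The coordinate change from the first chart to the second.\<close>

definition transition :: "('m, 'e) chart \<Rightarrow> ('m, 'e) chart \<Rightarrow> 'e \<Rightarrow> 'e" where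
  "transition c d = snd d \<circ> inv_into (fst c) (snd c)"

text \<open>
  Second countability is not listed: it is automatic for the compact manifolds considered below.
\<close>

definition smooth_atlas :: "('m::t2_space, 'e::real_inner) chart set \<Rightarrow> bool" where
  "smooth_atlas \<A> \<longleftrightarrow>
     (\<exists>B::'e set. finite B \<and> span B = UNIV) \<and>
     (\<forall>c\<in>\<A>. is_chart c) \<and>
     (\<Union>c\<in>\<A>. fst c) = UNIV \<and>
     (\<forall>c\<in>\<A>. \<forall>d\<in>\<A>. smooth_on (snd c ` (fst c \<inter> fst d)) (transition c d))"

definition smooth_map :: "('m::t2_space, 'e::real_inner) chart set \<Rightarrow> ('m \<Rightarrow> 'm) \<Rightarrow> bool" where
  "smooth_map \<A> f \<longleftrightarrow> continuous_on UNIV f \<and>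
     (\<forall>(U, \<phi>)\<in>\<A>. \<forall>(V, \<psi>)\<in>\<A>. smooth_on (\<phi> ` (U \<inter> f -` V)) (\<psi> \<circ> f \<circ> inv_into U \<phi>))"

definition diffeomorphism :: "('m::t2_space, 'e::real_inner) chart set \<Rightarrow> ('m \<Rightarrow> 'm) \<Rightarrow> bool" where
  "diffeomorphism \<A> f \<longleftrightarrow> bij f \<and> smooth_map \<A> f \<and> smooth_map \<A> (inv_into UNIV f)"

definition Diff :: "('m::t2_space, 'e::real_inner) chart set \<Rightarrow> ('m \<Rightarrow> 'm) monoid" where
  "Diff \<A> = \<lparr>carrier = {f. diffeomorphism \<A> f}, mult = (\<circ>), one = id\<rparr>"

text \<open>
  A Riemannian metric is given by its coordinate expressions: \<open>g c p v w\<close> is the inner product at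
  \<open>p\<close> of the tangent vectors whose components in the chart \<open>c\<close> are \<open>v\<close> and \<open>w\<close>.  The last condition
  is the transformation law of a covariant 2-tensor, which makes the value independent of \<open>c\<close>.
\<close>

definition riemannian_metric ::
  "('m::t2_space, 'e::real_inner) chart set \<Rightarrow>
   (('m, 'e) chart \<Rightarrow> 'm \<Rightarrow> 'e \<Rightarrow> 'e \<Rightarrow> real) \<Rightarrow> bool" where
  "riemannian_metric \<A> g \<longleftrightarrow>
     (\<forall>c\<in>\<A>. \<forall>p\<in>fst c. bilinear (g c p) \<and> (\<forall>v w. g c p v w = g c p w v) \<and>
        (\<forall>v. v \<noteq> 0 \<longrightarrow> g c p v v > 0)) \<and>
     (\<forall>c\<in>\<A>. \<forall>v w. smooth_on (snd c ` fst c) (\<lambda>x. g c (inv_into (fst c) (snd c) x) v w)) \<and>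
     (\<forall>c\<in>\<A>. \<forall>d\<in>\<A>. \<forall>p\<in>fst c \<inter> fst d. \<forall>v w.
        g c p v w = g d p (frechet_derivative (transition c d) (at (snd c p)) v)
                          (frechet_derivative (transition c d) (at (snd c p)) w))"

definition compact_riemannian_manifold ::
  "('m::t2_space, 'e::real_inner) chart set \<Rightarrow>
   (('m, 'e) chart \<Rightarrow> 'm \<Rightarrow> 'e \<Rightarrow> 'e \<Rightarrow> real) \<Rightarrow> bool" where
  "compact_riemannian_manifold \<A> g \<longleftrightarrow>
     compact (UNIV :: 'm set) \<and> smooth_atlas \<A> \<and> riemannian_metric \<A> g"


section \<open>The discrete Heisenberg group\<close>

datatype heisenberg_gen = Gen_A | Gen_B | Gen_C

text \<open>
  Words in the generators and their inverses: \<open>(x, True)\<close> is the generator \<open>x\<close> and \<open>(x, False)\<close>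
  its formal inverse.  The group is the set of words modulo the congruence generated by free
  cancellation and the relations \<open>AC = CA\<close>, \<open>BC = CB\<close>, \<open>AB = BAC\<close>.
\<close>

type_synonym heisenberg_word = "(heisenberg_gen \<times> bool) list"

inductive heisenberg_eq :: "heisenberg_word \<Rightarrow> heisenberg_word \<Rightarrow> bool" where
  heq_refl: "heisenberg_eq u u"
| heq_sym: "heisenberg_eq u v \<Longrightarrow> heisenberg_eq v u"
| heq_trans: "heisenberg_eq u v \<Longrightarrow> heisenberg_eq v w \<Longrightarrow> heisenberg_eq u w"
| heq_append: "heisenberg_eq u u' \<Longrightarrow> heisenberg_eq v v' \<Longrightarrow> heisenberg_eq (u @ v) (u' @ v')"
| heq_cancel: "heisenberg_eq [(x, b), (x, \<not> b)] []"
| heq_AC: "heisenberg_eq [(Gen_A, True), (Gen_C, True)] [(Gen_C, True), (Gen_A, True)]"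
| heq_BC: "heisenberg_eq [(Gen_B, True), (Gen_C, True)] [(Gen_C, True), (Gen_B, True)]"
| heq_AB: "heisenberg_eq [(Gen_A, True), (Gen_B, True)]
                         [(Gen_B, True), (Gen_A, True), (Gen_C, True)]"

definition heisenberg_class :: "heisenberg_word \<Rightarrow> heisenberg_word set" where
  "heisenberg_class u = {v. heisenberg_eq u v}"

definition Heisenberg :: "heisenberg_word set monoid" where
  "Heisenberg =
     \<lparr>carrier = range heisenberg_class,
      mult = (\<lambda>X Y. \<Union>u\<in>X. \<Union>v\<in>Y. heisenberg_class (u @ v)),
      one = heisenberg_class []\<rparr>"

definition heisenberg_elem :: "heisenberg_gen \<Rightarrow> heisenberg_word set" where
  "heisenberg_elem x = heisenberg_class [(x, True)]"

lemma equivp_heisenberg_eq: "equivp heisenberg_eq"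
  by (rule equivpI; rule reflpI sympI transpI) (fact heq_refl heq_sym heq_trans)+

lemma heisenberg_class_eq_iff: "heisenberg_class u = heisenberg_class v \<longleftrightarrow> heisenberg_eq u v"
  using equivp_heisenberg_eq by (auto simp: heisenberg_class_def equivp_def)

lemma heisenberg_mult_class:
  "heisenberg_class u \<otimes>\<^bsub>Heisenberg\<^esub> heisenberg_class v = heisenberg_class (u @ v)"
proof -
  have "heisenberg_class (u' @ v') = heisenberg_class (u @ v)"
    if "u' \<in> heisenberg_class u" "v' \<in> heisenberg_class v" for u' v'
    unfolding heisenberg_class_eq_iff
    by (rule heq_append; rule heq_sym) (use that in \<open>simp_all add: heisenberg_class_def\<close>)
  moreover have "w \<in> heisenberg_class w" for w
    by (simp add: heisenberg_class_def heq_refl)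
  ultimately show ?thesis
    unfolding Heisenberg_def monoid.simps by blast
qed

lemma heisenberg_left_inverse: "\<exists>v. heisenberg_eq (v @ u) []"
proof (induction u)
  case Nil
  have "heisenberg_eq ([] @ []) []" by (simp add: heq_refl)
  then show ?case ..
next
  case (Cons a u)
  then obtain v where v: "heisenberg_eq (v @ u) []" by blast
  obtain x b where a: "a = (x, b)" by (cases a)
  have "heisenberg_eq [(x, \<not> b), (x, b)] []"
    using heq_cancel[of x "\<not> b"] by simp
  then have "heisenberg_eq (v @ ([(x, \<not> b), (x, b)] @ u)) (v @ ([] @ u))"
    by (intro heq_append heq_refl)
  then have "heisenberg_eq ((v @ [(x, \<not> b)]) @ (a # u)) []"
    using heq_trans[OF _ v] by (simp add: a)
  then show ?case by blast
qed

lemma group_Heisenberg: "group Heisenberg"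
proof (rule groupI)
  show "\<one>\<^bsub>Heisenberg\<^esub> \<in> carrier Heisenberg"
    by (simp add: Heisenberg_def)
next
  fix X Y assume "X \<in> carrier Heisenberg" "Y \<in> carrier Heisenberg"
  then obtain u v where "X = heisenberg_class u" "Y = heisenberg_class v"
    by (auto simp: Heisenberg_def)
  moreover have "heisenberg_class w \<in> carrier Heisenberg" for w
    by (simp add: Heisenberg_def)
  ultimately show "X \<otimes>\<^bsub>Heisenberg\<^esub> Y \<in> carrier Heisenberg"
    by (simp add: heisenberg_mult_class)
next
  fix X Y Z
  assume "X \<in> carrier Heisenberg" "Y \<in> carrier Heisenberg" "Z \<in> carrier Heisenberg"
  then obtain u v w where "X = heisenberg_class u" "Y = heisenberg_class v" "Z = heisenberg_class w"
    by (auto simp: Heisenberg_def)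
  then show "X \<otimes>\<^bsub>Heisenberg\<^esub> Y \<otimes>\<^bsub>Heisenberg\<^esub> Z = X \<otimes>\<^bsub>Heisenberg\<^esub> (Y \<otimes>\<^bsub>Heisenberg\<^esub> Z)"
    by (simp add: heisenberg_mult_class)
next
  have one: "\<one>\<^bsub>Heisenberg\<^esub> = heisenberg_class []"
    by (simp add: Heisenberg_def)
  fix X assume "X \<in> carrier Heisenberg"
  then obtain u where X: "X = heisenberg_class u"
    by (auto simp: Heisenberg_def)
  show "\<one>\<^bsub>Heisenberg\<^esub> \<otimes>\<^bsub>Heisenberg\<^esub> X = X"
    by (simp add: X one heisenberg_mult_class)
  obtain v where "heisenberg_eq (v @ u) []"
    using heisenberg_left_inverse by blast
  then have "heisenberg_class v \<otimes>\<^bsub>Heisenberg\<^esub> X = \<one>\<^bsub>Heisenberg\<^esub>"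
    by (simp add: X one heisenberg_mult_class heisenberg_class_eq_iff)
  moreover have "heisenberg_class v \<in> carrier Heisenberg"
    by (simp add: Heisenberg_def)
  ultimately show "\<exists>Y\<in>carrier Heisenberg. Y \<otimes>\<^bsub>Heisenberg\<^esub> X = \<one>\<^bsub>Heisenberg\<^esub>"
    by blast
qed


section \<open>Topological entropy\<close>

text \<open>
  The Adler--Konheim--McAndrew definition, for a continuous self-map of a compact space.
\<close>

definition open_cover :: "'m::topological_space set set \<Rightarrow> bool" where
  "open_cover \<U> \<longleftrightarrow> (\<forall>U\<in>\<U>. open U) \<and> \<Union>\<U> = UNIV"

definition min_subcover_card :: "'m set set \<Rightarrow> nat" where
  "min_subcover_card \<U> = (LEAST k. \<exists>\<V>\<subseteq>\<U>. finite \<V> \<and> card \<V> = k \<and> \<Union>\<V> = UNIV)"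

text \<open>The join of the covers \<open>\<U>, f\<^sup>-\<^sup>1\<U>, \<dots>\<close> by the preimages under the first \<open>n\<close> iterates of \<open>f\<close>.\<close>

definition iterated_join :: "('m \<Rightarrow> 'm) \<Rightarrow> nat \<Rightarrow> 'm set set \<Rightarrow> 'm set set" where
  "iterated_join f n \<U> = {\<Inter>i<n. (f ^^ i) -` V i |V. \<forall>i<n. V i \<in> \<U>}"

text \<open>
  The limit defining the entropy relative to a cover exists by subadditivity, so that the upper
  limit used here is that limit.
\<close>

definition cover_entropy :: "('m \<Rightarrow> 'm) \<Rightarrow> 'm set set \<Rightarrow> ereal" where
  "cover_entropy f \<U> =
     limsup (\<lambda>n. ereal (ln (real (min_subcover_card (iterated_join f n \<U>))) / real n))"

definition topological_entropy :: "('m::topological_space \<Rightarrow> 'm) \<Rightarrow> ereal" where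
  "topological_entropy f = (SUP \<U>\<in>{\<U>. open_cover \<U>}. cover_entropy f \<U>)"

end

theory Submission
  imports Defs "HOL-Real_Asymp.Real_Asymp"
begin

text \<open>
  Let \<open>a\<close>, \<open>b\<close>, \<open>c\<close> be the diffeomorphisms by which \<open>A\<close>, \<open>B\<close>, \<open>C\<close> act, so that \<open>h = c\<close>.  The reason
  for the vanishing of the entropy is that the centre of the Heisenberg group is distorted: the
  commutator of \<open>A\<^sup>m\<close> and \<open>B\<^sup>n\<close> is \<open>C\<close> to the power \<open>m n\<close> (lemma \<open>heisenberg_commutator\<close>), whence
  every power \<open>c\<^sup>j\<close> with \<open>j < n\<^sup>2\<close> is a composition of at most \<open>5 n\<close> of the maps \<open>a\<close>, \<open>b\<close>, \<open>c\<close>, \<open>a\<^sup>-\<^sup>1\<close>,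
  \<open>b\<^sup>-\<^sup>1\<close>.  If these five maps multiply small distances by at most \<open>L\<close>, the first \<open>N\<close> iterates of \<open>h\<close>
  multiply them by at most \<open>L\<close> to a power of order \<open>sqrt N\<close>, instead of order \<open>N\<close>.

  Cover the compact manifold, of dimension \<open>D\<close>, by sets of diameter \<open>\<epsilon>\<close>; the order of \<open>\<epsilon>\<close> to the power
  \<open>-D\<close> many suffice.  For \<open>\<epsilon>\<close> equal to a Lebesgue number of an open cover divided by the stretching
  factor of the first \<open>N\<close> iterates, these sets refine the \<open>N\<close>-fold iterated join of the cover, so that
  the logarithm of the minimal cardinality of a subcover of the join is of order \<open>sqrt N\<close>.  Divided by \<open>N\<close>
  it tends to zero (lemma \<open>zero_entropy_of_sublinear_stretching\<close>).

  Distances are measured in charts: the manifold is covered by finitely many compact sets, each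
  inside the domain of a chart, and two points count as \<open>\<epsilon>\<close>-close if in one of these sets their
  coordinates differ by at most \<open>\<epsilon>\<close>.  This relation need not be transitive, but it has the
  three properties that the argument needs: a Lebesgue number (\<open>near_lebesgue_number\<close>), a Lipschitz
  constant at small scales for every smooth map (\<open>near_lipschitz\<close>), and covers of polynomial size
  (\<open>near_cells_cover\<close>).
\<close>

section \<open>Finite-dimensional inner product spaces\<close>

text \<open>
  The model space is known only to have a finite spanning set; normalising the nonzero vectors of an
  orthogonal one gives coordinates in which norms can be estimated.
\<close>

lemma orthonormal_basis_exists:
  assumes "finite (B :: 'e::real_inner set)" "span B = UNIV"
  obtains C :: "'e::real_inner set" where "finite C" "\<And>c. c \<in> C \<Longrightarrow> norm c = 1"
    "\<And>x. (\<Sum>c\<in>C. (x \<bullet> c) *\<^sub>R c) = x"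
proof -
  obtain C0 :: "'e set" where C0: "finite C0" "span C0 = UNIV" "pairwise orthogonal C0"
    using basis_orthogonal[OF assms(1)] unfolding assms(2) by blast
  define C1 where "C1 = C0 - {0}"
  have C1: "finite C1" "span C1 = UNIV" "pairwise orthogonal C1" "0 \<notin> C1"
    using C0 by (auto simp: C1_def span_delete_0 pairwise_def)
  define C where "C = (\<lambda>c. c /\<^sub>R norm c) ` C1"
  have inj: "inj_on (\<lambda>c. c /\<^sub>R norm c) C1"
  proof (rule inj_onI, rule ccontr)
    fix c d assume "c \<in> C1" "d \<in> C1" and eq: "c /\<^sub>R norm c = d /\<^sub>R norm d" and "c \<noteq> d"
    then have "c \<bullet> d = 0" "c \<noteq> 0" "d \<noteq> 0"
      using C1 by (auto simp: pairwise_def orthogonal_def)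
    have "(c /\<^sub>R norm c) \<bullet> c = (d /\<^sub>R norm d) \<bullet> c" using eq by simp
    then show False using \<open>c \<bullet> d = 0\<close> \<open>c \<noteq> 0\<close> by (simp add: inner_commute)
  qed
  have expand: "(\<Sum>c\<in>C1. (x \<bullet> c / (c \<bullet> c)) *\<^sub>R c) = x" for x
  proof -
    define y where "y = x - (\<Sum>c\<in>C1. (x \<bullet> c / (c \<bullet> c)) *\<^sub>R c)"
    have orth: "orthogonal y d" if "d \<in> C1" for d
    proof -
      have "(\<Sum>c\<in>C1. (x \<bullet> c / (c \<bullet> c)) *\<^sub>R c) \<bullet> d = (\<Sum>c\<in>C1. (x \<bullet> c / (c \<bullet> c)) * (c \<bullet> d))"
        by (simp add: inner_sum_left)
      also have "\<dots> = (\<Sum>c\<in>C1. if c = d then x \<bullet> d else 0)"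
        using C1 that by (intro sum.cong) (auto simp: pairwise_def orthogonal_def)
      also have "\<dots> = x \<bullet> d" using that C1 by simp
      finally show ?thesis by (simp add: y_def orthogonal_def inner_diff_left)
    qed
    have "y \<in> span C1" using C1 by simp
    then have "orthogonal y y" using orthogonal_to_span orth by blast
    then show ?thesis by (simp add: y_def orthogonal_self)
  qed
  show ?thesis
  proof
    show "finite C" using C1 by (simp add: C_def)
    have "c \<noteq> 0" if "c \<in> C1" for c using that C1(4) by blast
    then show "norm c = 1" if "c \<in> C" for c using that by (auto simp: C_def)
    have "(\<Sum>c\<in>C. (x \<bullet> c) *\<^sub>R c) = (\<Sum>c\<in>C1. (x \<bullet> c / (c \<bullet> c)) *\<^sub>R c)" for x
      unfolding C_def sum.reindex[OF inj] o_def
      by (intro sum.cong refl) (simp add: dot_square_norm power2_eq_square divide_simps)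
    then show "(\<Sum>c\<in>C. (x \<bullet> c) *\<^sub>R c) = x" for x using expand by simp
  qed
qed

text \<open>
  The operator norm of the derivative is bounded by the sum of the norms of its values on an
  orthonormal basis.  These finitely many values vary continuously, so their bounds at one point
  persist, up to an increase by 1, on a ball, where the mean value inequality applies.
\<close>

lemma C1_imp_locally_lipschitz:
  fixes f :: "'e::real_inner \<Rightarrow> 'b::real_normed_vector"
  assumes "finite (B :: 'e set)" "span B = UNIV"
    and S: "open S" "x \<in> S" and f: "Ck_on (Suc 0) S f"
  obtains r L where "r > 0" "ball x r \<subseteq> S"
    "\<And>y z. y \<in> ball x r \<Longrightarrow> z \<in> ball x r \<Longrightarrow> norm (f y - f z) \<le> L * norm (y - z)"
proof -
  obtain C :: "'e set" where C: "finite C" "\<And>c. c \<in> C \<Longrightarrow> norm c = 1"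
    "\<And>x. (\<Sum>c\<in>C. (x \<bullet> c) *\<^sub>R c) = x"
    using orthonormal_basis_exists assms(1,2) by blast
  define D where "D = (\<lambda>y. frechet_derivative f (at y))"
  have D: "(f has_derivative D y) (at y)" if "y \<in> S" for y
    using f that by (simp add: D_def frechet_derivative_works)
  have cont: "continuous_on S (\<lambda>y. D y v)" for v
    using f by (simp add: D_def)
  have "\<forall>c\<in>C. \<forall>\<^sub>F y in nhds x. norm (D y c) < norm (D x c) + 1"
  proof
    fix c
    have "isCont (\<lambda>y. norm (D y c)) x"
      using cont S by (simp add: continuous_on_eq_continuous_at)
    then have "((\<lambda>y. norm (D y c)) \<longlongrightarrow> norm (D x c)) (nhds x)"
      using tendsto_at_iff_tendsto_nhds[of "\<lambda>y. norm (D y c)" x] by (simp add: isCont_def)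
    then show "\<forall>\<^sub>F y in nhds x. norm (D y c) < norm (D x c) + 1"
      by (rule order_tendstoD) simp
  qed
  then have "\<forall>\<^sub>F y in nhds x. (\<forall>c\<in>C. norm (D y c) < norm (D x c) + 1) \<and> y \<in> S"
    using S C(1) by (auto intro: eventually_conj eventually_ball_finite eventually_nhds_in_open)
  then obtain r where r: "r > 0"
    "\<And>y. dist y x < r \<Longrightarrow> (\<forall>c\<in>C. norm (D y c) < norm (D x c) + 1) \<and> y \<in> S"
    unfolding eventually_nhds_metric by blast
  define L where "L = (\<Sum>c\<in>C. norm (D x c) + 1)"
  have bound: "onorm (D y) \<le> L" if y: "y \<in> ball x r" for y
  proof (rule onorm_bound)
    show "0 \<le> L" unfolding L_def by (intro sum_nonneg) simp
    fix v
    have "y \<in> S" using r y by (simp add: dist_commute)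
    then have lin: "linear (D y)" using D has_derivative_linear by blast
    have "norm (D y v) = norm (D y (\<Sum>c\<in>C. (v \<bullet> c) *\<^sub>R c))" using C by simp
    also have "\<dots> = norm (\<Sum>c\<in>C. (v \<bullet> c) *\<^sub>R D y c)"
      by (simp add: linear_sum[OF lin] linear_cmul[OF lin])
    also have "\<dots> \<le> (\<Sum>c\<in>C. \<bar>v \<bullet> c\<bar> * norm (D y c))"
      by (rule order_trans[OF norm_sum]) simp
    also have "\<dots> \<le> (\<Sum>c\<in>C. norm v * (norm (D x c) + 1))"
    proof (intro sum_mono mult_mono)
      fix c assume "c \<in> C"
      then show "\<bar>v \<bullet> c\<bar> \<le> norm v" using Cauchy_Schwarz_ineq2[of v c] C by simp
      show "norm (D y c) \<le> norm (D x c) + 1"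
        using r y \<open>c \<in> C\<close> by (force simp: dist_commute)
    qed auto
    also have "\<dots> = L * norm v" by (simp add: L_def sum_distrib_left mult.commute)
    finally show "norm (D y v) \<le> L * norm v" .
  qed
  show ?thesis
  proof
    show "r > 0" by fact
    show sub: "ball x r \<subseteq> S" using r by (auto simp: dist_commute)
    show "norm (f y - f z) \<le> L * norm (y - z)" if "y \<in> ball x r" "z \<in> ball x r" for y z
    proof (rule differentiable_bound[OF convex_ball _ bound that])
      fix y assume "y \<in> ball x r"
      then show "(f has_derivative D y) (at y within ball x r)"
        using sub by (blast intro: has_derivative_at_withinI D)
    qed
  qed
qed

text \<open>
  A bounded set meets only polynomially many cubes of a grid, where the exponent is the dimension
  and the variable is the inverse mesh.
\<close>

lemma small_cells_cover:
  fixes S C :: "'e::real_inner set"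
  assumes C: "finite C" "\<And>c. c \<in> C \<Longrightarrow> norm c = 1" "\<And>x. (\<Sum>c\<in>C. (x \<bullet> c) *\<^sub>R c) = x"
    and "bounded S"
  obtains k where
    "\<And>\<epsilon>. 0 < \<epsilon> \<Longrightarrow> \<epsilon> \<le> 1 \<Longrightarrow> \<exists>\<P>. finite \<P> \<and> S \<subseteq> \<Union>\<P> \<and> real (card \<P>) \<le> k * (1 / \<epsilon>) ^ card C \<and>
      (\<forall>P\<in>\<P>. \<forall>x\<in>P. \<forall>y\<in>P. norm (x - y) \<le> \<epsilon>)"
proof -
  obtain R where R: "R > 0" "\<And>x. x \<in> S \<Longrightarrow> norm x \<le> R"
    using \<open>bounded S\<close> by (auto simp: bounded_pos)
  define d where "d = real (card C) + 1"
  have d: "d > 0" by (simp add: d_def)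
  define k where "k = 2 * (R * d) + 3"
  show ?thesis
  proof (rule that)
    fix \<epsilon> :: real assume \<epsilon>: "0 < \<epsilon>" "\<epsilon> \<le> 1"
    \<comment> \<open>The mesh \<open>\<epsilon> / d\<close> makes the sum of the coordinate differences in a cube at most \<open>\<epsilon>\<close>.\<close>
    define cell where "cell = (\<lambda>x. \<lambda>c\<in>C. \<lfloor>(x \<bullet> c) * d / \<epsilon>\<rfloor>)"
    define m where "m = \<lceil>R * d / \<epsilon>\<rceil>"
    define \<P> where "\<P> = (\<lambda>i. {x. cell x = i}) ` (PiE C (\<lambda>_. {-m..m}))"
    have m: "m \<ge> 0" "real_of_int m \<le> R * d / \<epsilon> + 1" "R * d / \<epsilon> \<le> m"
    proof -
      have "0 \<le> R * d / \<epsilon>" using R d \<epsilon> by simp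
      then show "m \<ge> 0" unfolding m_def by linarith
    qed (auto simp: m_def; linarith)+
    have cell: "cell x \<in> PiE C (\<lambda>_. {-m..m})" if "x \<in> S" for x
    proof (rule PiE_I)
      fix c assume c: "c \<in> C"
      have "\<bar>x \<bullet> c\<bar> \<le> R" using Cauchy_Schwarz_ineq2[of x c] C c R that by fastforce
      then have "\<bar>x \<bullet> c\<bar> * (d / \<epsilon>) \<le> R * (d / \<epsilon>)" using d \<epsilon> by (intro mult_right_mono) auto
      then have "\<bar>(x \<bullet> c) * d / \<epsilon>\<bar> \<le> m" using m d \<epsilon> by (simp add: abs_mult)
      then have "- real_of_int m \<le> (x \<bullet> c) * d / \<epsilon>" "(x \<bullet> c) * d / \<epsilon> \<le> m" by linarith+
      then have "\<lfloor>(x \<bullet> c) * d / \<epsilon>\<rfloor> \<in> {-m..m}" by (simp add: le_floor_iff floor_le_iff)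
      then show "cell x c \<in> {-m..m}" using c by (simp add: cell_def)
    qed (simp add: cell_def)
    show "\<exists>\<P>. finite \<P> \<and> S \<subseteq> \<Union>\<P> \<and> real (card \<P>) \<le> k ^ card C * (1 / \<epsilon>) ^ card C \<and>
      (\<forall>P\<in>\<P>. \<forall>x\<in>P. \<forall>y\<in>P. norm (x - y) \<le> \<epsilon>)"
    proof (intro exI conjI ballI)
      show "finite \<P>" using C by (simp add: \<P>_def finite_PiE)
      show "S \<subseteq> \<Union>\<P>" using cell by (auto simp: \<P>_def)
      have "real (card \<P>) \<le> real (card (PiE C (\<lambda>_. {-m..m})))"
        using C by (simp add: \<P>_def finite_PiE card_image_le)
      also have "\<dots> = (2 * real_of_int m + 1) ^ card C" using m(1) C by (simp add: card_PiE)
      also have "\<dots> \<le> (k * (1 / \<epsilon>)) ^ card C"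
      proof (rule power_mono)
        have "2 * real_of_int m + 1 \<le> 2 * (R * d / \<epsilon>) + 3" using m by simp
        also have "\<dots> \<le> 2 * (R * d / \<epsilon>) + 3 / \<epsilon>" using \<epsilon> by (simp add: divide_simps)
        finally show "2 * real_of_int m + 1 \<le> k * (1 / \<epsilon>)" by (simp add: k_def add_divide_distrib)
      qed (use m in auto)
      finally show "real (card \<P>) \<le> k ^ card C * (1 / \<epsilon>) ^ card C"
        by (simp only: power_mult_distrib)
      fix P x y assume "P \<in> \<P>" "x \<in> P" "y \<in> P"
      then have eq: "cell x = cell y" by (auto simp: \<P>_def)
      have coord: "\<bar>(x - y) \<bullet> c\<bar> \<le> \<epsilon> / d" if "c \<in> C" for c
      proof -
        have "\<lfloor>(x \<bullet> c) * d / \<epsilon>\<rfloor> = \<lfloor>(y \<bullet> c) * d / \<epsilon>\<rfloor>"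
          using fun_cong[OF eq, of c] that by (simp add: cell_def)
        then have "\<bar>(x \<bullet> c) * d / \<epsilon> - (y \<bullet> c) * d / \<epsilon>\<bar> \<le> 1" by linarith
        also have "(x \<bullet> c) * d / \<epsilon> - (y \<bullet> c) * d / \<epsilon> = ((x - y) \<bullet> c) * (d / \<epsilon>)"
          by (simp add: inner_diff_left algebra_simps diff_divide_distrib)
        finally show ?thesis using d \<epsilon> by (simp add: abs_mult field_simps)
      qed
      have "norm (x - y) = norm (\<Sum>c\<in>C. ((x - y) \<bullet> c) *\<^sub>R c)" using C by simp
      also have "\<dots> \<le> (\<Sum>c\<in>C. \<bar>(x - y) \<bullet> c\<bar>)"
        by (rule order_trans[OF norm_sum]) (simp add: C)
      also have "\<dots> \<le> (\<Sum>c\<in>C. \<epsilon> / d)" by (intro sum_mono coord)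
      also have "\<dots> \<le> \<epsilon>" using \<epsilon> d by (simp add: d_def field_simps)
      finally show "norm (x - y) \<le> \<epsilon>" .
    qed
  qed
qed

section \<open>Closeness in finitely many compact chart pieces\<close>

definition compact_pieces :: "('m::t2_space, 'e::real_inner) chart set \<Rightarrow> ('m, 'e) chart set \<Rightarrow> bool" where
  "compact_pieces \<A> \<K> \<longleftrightarrow> finite \<K> \<and>
     (\<forall>(K, \<phi>)\<in>\<K>. compact K \<and> (\<exists>U. K \<subseteq> U \<and> (U, \<phi>) \<in> \<A>)) \<and> (\<Union>(K, \<phi>)\<in>\<K>. interior K) = UNIV"

definition near :: "('m, 'e::real_normed_vector) chart set \<Rightarrow> real \<Rightarrow> 'm \<Rightarrow> 'm \<Rightarrow> bool" where
  "near \<K> \<epsilon> p q \<longleftrightarrow> (\<exists>(K, \<phi>)\<in>\<K>. p \<in> K \<and> q \<in> K \<and> norm (\<phi> p - \<phi> q) \<le> \<epsilon>)"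

lemma near_mono: "near \<K> \<epsilon> p q \<Longrightarrow> \<epsilon> \<le> \<epsilon>' \<Longrightarrow> near \<K> \<epsilon>' p q"
  by (force simp: near_def)

text \<open>
  Finitely many open sets that are disjoint from a neighbourhood of \<open>p\<close> cover the compact complement
  of \<open>U\<close>; the complement of their union is the required set.
\<close>

lemma compact_hausdorff_neighbourhood:
  fixes p :: "'m::t2_space"
  assumes "compact (UNIV :: 'm set)" "open U" "p \<in> U"
  obtains K where "compact K" "p \<in> interior K" "K \<subseteq> U"
proof -
  have "\<forall>y\<in>-U. \<exists>V W. open V \<and> open W \<and> y \<in> V \<and> p \<in> W \<and> V \<inter> W = {}"
    using assms(3) by (metis ComplD hausdorff)
  then obtain V W where VW: "\<And>y. y \<in> -U \<Longrightarrow> open (V y)" "\<And>y. y \<in> -U \<Longrightarrow> open (W y)"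
    "\<And>y. y \<in> -U \<Longrightarrow> y \<in> V y" "\<And>y. y \<in> -U \<Longrightarrow> p \<in> W y" "\<And>y. y \<in> -U \<Longrightarrow> V y \<inter> W y = {}"
    by metis
  have "compact (-U)"
    using compact_Int_closed[OF assms(1), of "-U"] assms(2) by (simp add: closed_Compl)
  then obtain F where F: "F \<subseteq> -U" "finite F" "-U \<subseteq> (\<Union>y\<in>F. V y)"
    using VW by (elim compactE_image[of "-U" "-U" V]) auto
  show ?thesis
  proof
    have "closed (- (\<Union>y\<in>F. V y))" using F VW by (intro closed_Compl open_UN) blast
    then show "compact (- (\<Union>y\<in>F. V y))"
      using compact_Int_closed[OF assms(1)] by simp
    have "open (\<Inter>y\<in>F. W y)" using F VW by (intro open_INT) auto
    moreover have "p \<in> (\<Inter>y\<in>F. W y)" using F VW by auto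
    moreover have "(\<Inter>y\<in>F. W y) \<subseteq> - (\<Union>y\<in>F. V y)" using F(1) VW(5) by fastforce
    ultimately show "p \<in> interior (- (\<Union>y\<in>F. V y))" by (metis interiorI)
    show "- (\<Union>y\<in>F. V y) \<subseteq> U" using F by auto
  qed
qed

lemma compact_pieces_exist:
  fixes \<A> :: "('m::t2_space, 'e::real_inner) chart set"
  assumes cpt: "compact (UNIV :: 'm set)" and atlas: "smooth_atlas \<A>"
  obtains \<K> where "compact_pieces \<A> \<K>"
proof -
  have "\<exists>K \<phi> U. compact K \<and> p \<in> interior K \<and> K \<subseteq> U \<and> (U, \<phi>) \<in> \<A>" for p
  proof -
    have "p \<in> (\<Union>c\<in>\<A>. fst c)" using atlas by (simp add: smooth_atlas_def)
    then obtain U \<phi> where U: "(U, \<phi>) \<in> \<A>" "p \<in> U" by auto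
    then have "open U" using atlas by (force simp: smooth_atlas_def is_chart_def)
    then show ?thesis using compact_hausdorff_neighbourhood[OF cpt] U by metis
  qed
  then obtain K \<phi> U where K: "\<And>p::'m. compact (K p)" "\<And>p. p \<in> interior (K p)"
    "\<And>p. K p \<subseteq> U p" "\<And>p. (U p, \<phi> p) \<in> \<A>" by metis
  obtain F where F: "finite F" "UNIV \<subseteq> (\<Union>p\<in>F. interior (K p))"
    by (rule compactE_image[OF cpt, of UNIV "\<lambda>p. interior (K p)"]) (use K in auto)
  have "compact_pieces \<A> ((\<lambda>p. (K p, \<phi> p)) ` F)"
    unfolding compact_pieces_def
  proof (intro conjI)
    show "finite ((\<lambda>p. (K p, \<phi> p)) ` F)" using F(1) by simp
    show "\<forall>(L, \<psi>)\<in>(\<lambda>p. (K p, \<phi> p)) ` F. compact L \<and> (\<exists>V. L \<subseteq> V \<and> (V, \<psi>) \<in> \<A>)"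
      using K(1,3,4) by blast
    show "(\<Union>(L, \<psi>)\<in>(\<lambda>p. (K p, \<phi> p)) ` F. interior L) = UNIV"
      using F(2) by auto
  qed
  then show ?thesis by (rule that)
qed

text \<open>
  The next two lemmas make a choice of scale uniform: over finitely many conditions, and over the
  points of a compact space.
\<close>

lemma uniform_scale_finite:
  fixes P :: "'i \<Rightarrow> real \<Rightarrow> bool"
  assumes "finite I" "\<And>i. i \<in> I \<Longrightarrow> \<exists>\<delta>>0. P i \<delta>"
    and mono: "\<And>i \<delta> \<delta>'. P i \<delta> \<Longrightarrow> 0 < \<delta>' \<Longrightarrow> \<delta>' \<le> \<delta> \<Longrightarrow> P i \<delta>'"
  shows "\<exists>\<delta>>0. \<forall>i\<in>I. P i \<delta>"
  using assms(1,2)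
proof (induction I)
  case empty
  show ?case by (intro exI[of _ 1]) simp
next
  case (insert i I)
  obtain \<delta> where "\<delta> > 0" "P i \<delta>" using insert.prems by blast
  moreover obtain \<delta>' where "\<delta>' > 0" "\<forall>j\<in>I. P j \<delta>'" using insert.IH insert.prems by blast
  ultimately show ?case by (intro exI[of _ "min \<delta> \<delta>'"]) (auto intro: mono)
qed

lemma uniform_scale_compact:
  fixes P :: "'m::topological_space \<Rightarrow> real \<Rightarrow> bool"
  assumes "compact (UNIV :: 'm set)" and loc: "\<And>p. \<exists>\<delta>>0. \<forall>\<^sub>F q in nhds p. P q \<delta>"
    and mono: "\<And>q \<delta> \<delta>'. P q \<delta> \<Longrightarrow> 0 < \<delta>' \<Longrightarrow> \<delta>' \<le> \<delta> \<Longrightarrow> P q \<delta>'"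
  shows "\<exists>\<delta>>0. \<forall>q. P q \<delta>"
proof -
  have "\<exists>\<delta>>0. \<exists>W. open W \<and> p \<in> W \<and> (\<forall>q\<in>W. P q \<delta>)" for p
    using loc[of p] by (simp add: eventually_nhds)
  then obtain W where W: "\<And>p. open (W p)" "\<And>p. p \<in> W p" "\<And>p. \<exists>\<delta>>0. \<forall>q\<in>W p. P q \<delta>"
    by metis
  obtain F where F: "finite F" "UNIV \<subseteq> (\<Union>p\<in>F. W p)"
    by (rule compactE_image[OF assms(1), of UNIV W]) (use W in auto)
  have "\<exists>\<delta>>0. \<forall>p\<in>F. \<forall>q\<in>W p. P q \<delta>"
    using F(1) W(3) by (rule uniform_scale_finite) (auto intro: mono)
  then show ?thesis using F(2) by blast
qed

lemma chart_properties:
  assumes "smooth_atlas \<A>" "(U, \<phi>) \<in> \<A>"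
  shows chart_open: "open U" and chart_inj: "inj_on \<phi> U" and chart_cont: "continuous_on U \<phi>"
    and chart_image_open: "\<And>V. open V \<Longrightarrow> open (\<phi> ` (U \<inter> V))"
proof -
  have "is_chart (U, \<phi>)" using assms by (auto simp: smooth_atlas_def)
  then obtain \<psi> where h: "open U" "open (\<phi> ` U)" "homeomorphism U (\<phi> ` U) \<phi> \<psi>"
    by (auto simp: is_chart_def)
  then show "open U" "continuous_on U \<phi>" by (auto simp: homeomorphism_def)
  show "inj_on \<phi> U" using h by (intro inj_on_inverseI[of _ \<psi>]) (auto simp: homeomorphism_def)
  show "open (\<phi> ` (U \<inter> V))" if "open V" for V
  proof -
    have "openin (top_of_set (\<phi> ` U)) (\<phi> ` (U \<inter> V))"
      by (rule homeomorphism_imp_open_map[OF h(3)]) (use that in blast)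
    then show ?thesis using h(2) openin_open_eq by blast
  qed
qed

lemma chart_eventually_near:
  assumes "smooth_atlas \<A>" "(U, \<phi>) \<in> \<A>" "p \<in> U" "s > 0"
  shows "\<forall>\<^sub>F q in nhds p. norm (\<phi> q - \<phi> p) < s"
proof -
  have "isCont \<phi> p"
    using chart_open[OF assms(1,2)] chart_cont[OF assms(1,2)] assms(3)
    by (simp add: continuous_on_eq_continuous_at)
  then have "(\<phi> \<longlongrightarrow> \<phi> p) (nhds p)" unfolding isCont_def tendsto_at_iff_tendsto_nhds .
  then show ?thesis using assms(4) by (simp add: tendsto_iff dist_norm)
qed

text \<open>
  Fix a point \<open>p\<close> and a member \<open>N\<close> of the cover around it.  A piece that does not contain \<open>p\<close> is
  disjoint from a neighbourhood of \<open>p\<close>, since it is closed.  In a piece that contains \<open>p\<close>, the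
  coordinate image of \<open>N\<close> contains a ball around the coordinates of \<open>p\<close>, and half of its radius
  serves all points near \<open>p\<close>.  As there are finitely many pieces, one scale serves a neighbourhood
  of \<open>p\<close>, and compactness gives a scale for the whole manifold.
\<close>

lemma near_lebesgue_number:
  fixes \<A> :: "('m::t2_space, 'e::real_inner) chart set"
  assumes cpt: "compact (UNIV :: 'm set)" and atlas: "smooth_atlas \<A>"
    and \<K>: "compact_pieces \<A> \<K>" and \<U>: "open_cover \<U>"
  obtains \<delta> where "\<delta> > 0" "\<And>p. \<exists>U\<in>\<U>. \<forall>q. near \<K> \<delta> p q \<longrightarrow> q \<in> U"
proof -
  have "\<exists>\<delta>>0. \<forall>p. \<exists>U\<in>\<U>. \<forall>q. near \<K> \<delta> p q \<longrightarrow> q \<in> U"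
  proof (rule uniform_scale_compact[OF cpt])
    fix p
    have "p \<in> \<Union>\<U>" using \<U> by (simp add: open_cover_def)
    then obtain N where N: "N \<in> \<U>" "open N" "p \<in> N" using \<U> by (auto simp: open_cover_def)
    have "\<exists>\<delta>>0. \<forall>k\<in>\<K>. \<forall>\<^sub>F q in nhds p.
        \<forall>q'. q \<in> fst k \<and> q' \<in> fst k \<and> norm (snd k q - snd k q') \<le> \<delta> \<longrightarrow> q' \<in> N"
    proof (rule uniform_scale_finite)
      show "finite \<K>" using \<K> by (simp add: compact_pieces_def)
      fix k assume "k \<in> \<K>"
      then obtain K \<phi> U where k: "k = (K, \<phi>)" "compact K" "K \<subseteq> U" "(U, \<phi>) \<in> \<A>"
        using \<K> by (cases k) (auto simp: compact_pieces_def)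
      show "\<exists>\<delta>>0. \<forall>\<^sub>F q in nhds p.
        \<forall>q'. q \<in> fst k \<and> q' \<in> fst k \<and> norm (snd k q - snd k q') \<le> \<delta> \<longrightarrow> q' \<in> N"
      proof (cases "p \<in> K")
        case False
        then have "\<forall>\<^sub>F q in nhds p. q \<in> - K"
          using k(2) by (intro eventually_nhds_in_open) (auto simp: compact_imp_closed)
        then show ?thesis by (intro exI[of _ 1]) (auto simp: k elim: eventually_mono)
      next
        case True
        have "open (\<phi> ` (U \<inter> N))" using chart_image_open[OF atlas k(4) N(2)] .
        moreover have "\<phi> p \<in> \<phi> ` (U \<inter> N)" using True k N by auto
        ultimately obtain r where r: "r > 0" "ball (\<phi> p) r \<subseteq> \<phi> ` (U \<inter> N)"
          by (meson open_contains_ball)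
        have "\<forall>\<^sub>F q in nhds p. norm (\<phi> q - \<phi> p) < r / 2"
          using True k(3) r by (intro chart_eventually_near[OF atlas k(4)]) auto
        then have "\<forall>\<^sub>F q in nhds p.
          \<forall>q'. q \<in> K \<and> q' \<in> K \<and> norm (\<phi> q - \<phi> q') \<le> r / 2 \<longrightarrow> q' \<in> N"
        proof (rule eventually_mono, intro allI impI)
          fix q q' assume *: "norm (\<phi> q - \<phi> p) < r / 2" "q \<in> K \<and> q' \<in> K \<and> norm (\<phi> q - \<phi> q') \<le> r / 2"
          have "dist (\<phi> p) (\<phi> q') < r"
            using * dist_triangle[of "\<phi> p" "\<phi> q'" "\<phi> q"] by (simp add: dist_norm norm_minus_commute)
          then have "\<phi> q' \<in> \<phi> ` (U \<inter> N)" using r by auto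
          then show "q' \<in> N"
            using chart_inj[OF atlas k(4)] * k(3) by (auto simp: inj_on_def)
        qed
        then show ?thesis using r k by (intro exI[of _ "r / 2"]) auto
      qed
    qed (auto elim!: eventually_mono)
    then obtain \<delta> where \<delta>: "\<delta> > 0" "\<forall>k\<in>\<K>. \<forall>\<^sub>F q in nhds p.
        \<forall>q'. q \<in> fst k \<and> q' \<in> fst k \<and> norm (snd k q - snd k q') \<le> \<delta> \<longrightarrow> q' \<in> N" by blast
    then have "\<forall>\<^sub>F q in nhds p. \<forall>k\<in>\<K>.
        \<forall>q'. q \<in> fst k \<and> q' \<in> fst k \<and> norm (snd k q - snd k q') \<le> \<delta> \<longrightarrow> q' \<in> N"
      using \<K> by (intro eventually_ball_finite) (auto simp: compact_pieces_def)
    then have "\<forall>\<^sub>F q in nhds p. \<exists>U\<in>\<U>. \<forall>q'. near \<K> \<delta> q q' \<longrightarrow> q' \<in> U"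
    proof (rule eventually_mono)
      fix q assume *: "\<forall>k\<in>\<K>. \<forall>q'. q \<in> fst k \<and> q' \<in> fst k \<and> norm (snd k q - snd k q') \<le> \<delta> \<longrightarrow> q' \<in> N"
      have "q' \<in> N" if near: "near \<K> \<delta> q q'" for q'
      proof -
        obtain k where "k \<in> \<K>" "q \<in> fst k" "q' \<in> fst k" "norm (snd k q - snd k q') \<le> \<delta>"
          using near by (auto simp: near_def case_prod_beta)
        then show ?thesis using * by blast
      qed
      then show "\<exists>U\<in>\<U>. \<forall>q'. near \<K> \<delta> q q' \<longrightarrow> q' \<in> U" using N(1) by blast
    qed
    then show "\<exists>\<delta>>0. \<forall>\<^sub>F q in nhds p. \<exists>U\<in>\<U>. \<forall>q'. near \<K> \<delta> q q' \<longrightarrow> q' \<in> U"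
      using \<delta>(1) by blast
  qed (meson near_mono)
  then show ?thesis using that by blast
qed

text \<open>
  Near \<open>p\<close>, the coordinate expression of \<open>f\<close> from a piece around \<open>p\<close> to a piece that contains \<open>f p\<close>
  in its interior is Lipschitz, and both images lie in that piece; finiteness and compactness make
  the constants uniform as for the Lebesgue number.  The single number \<open>\<delta>\<close> is both the scale up to
  which the estimate holds and the inverse of the Lipschitz constant, so that one monotone parameter
  has to be made uniform.
\<close>

lemma near_lipschitz:
  fixes \<A> :: "('m::t2_space, 'e::real_inner) chart set"
  assumes cpt: "compact (UNIV :: 'm set)" and atlas: "smooth_atlas \<A>"
    and \<K>: "compact_pieces \<A> \<K>" and f: "smooth_map \<A> f"
  obtains \<delta> where "\<delta> > 0"
    "\<And>\<epsilon> p q. \<epsilon> \<le> \<delta> \<Longrightarrow> near \<K> \<epsilon> p q \<Longrightarrow> near \<K> (\<epsilon> / \<delta>) (f p) (f q)"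
proof -
  obtain B :: "'e set" where B: "finite B" "span B = UNIV"
    using atlas by (auto simp: smooth_atlas_def)
  define P :: "('m, 'e) chart \<Rightarrow> 'm \<Rightarrow> real \<Rightarrow> bool" where "P = (\<lambda>k q \<delta>. \<forall>q' \<epsilon>. \<epsilon> \<le> \<delta> \<and> q \<in> fst k \<and> q' \<in> fst k \<and>
      norm (snd k q - snd k q') \<le> \<epsilon> \<longrightarrow> near \<K> (\<epsilon> / \<delta>) (f q) (f q'))"
  have Pmono: "P k q \<delta>'" if "P k q \<delta>" "0 < \<delta>'" "\<delta>' \<le> \<delta>" for k q \<delta> \<delta>'
    unfolding P_def
  proof (intro allI impI)
    fix q' \<epsilon> assume *: "\<epsilon> \<le> \<delta>' \<and> q \<in> fst k \<and> q' \<in> fst k \<and> norm (snd k q - snd k q') \<le> \<epsilon>"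
    then have "near \<K> (\<epsilon> / \<delta>) (f q) (f q')" using that by (auto simp: P_def)
    moreover have "0 \<le> \<epsilon>" using * norm_ge_zero order_trans by blast
    then have "\<epsilon> / \<delta> \<le> \<epsilon> / \<delta>'" using that by (simp add: frac_le)
    ultimately show "near \<K> (\<epsilon> / \<delta>') (f q) (f q')" by (rule near_mono)
  qed
  have "\<exists>\<delta>>0. \<forall>q. \<forall>k\<in>\<K>. P k q \<delta>"
  proof (rule uniform_scale_compact[OF cpt])
    fix p
    have "f p \<in> (\<Union>(K, \<phi>)\<in>\<K>. interior K)" using \<K> by (simp add: compact_pieces_def)
    then obtain J \<psi> where J: "(J, \<psi>) \<in> \<K>" "f p \<in> interior J" by auto
    then obtain V where V: "J \<subseteq> V" "(V, \<psi>) \<in> \<A>"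
      using \<K> by (fastforce simp: compact_pieces_def)
    have contf: "continuous_on UNIV f" using f by (simp add: smooth_map_def)
    have "\<exists>\<delta>>0. \<forall>k\<in>\<K>. \<forall>\<^sub>F q in nhds p. P k q \<delta>"
    proof (rule uniform_scale_finite)
      show "finite \<K>" using \<K> by (simp add: compact_pieces_def)
      fix k assume "k \<in> \<K>"
      then obtain K \<phi> U where k: "k = (K, \<phi>)" "compact K" "K \<subseteq> U" "(U, \<phi>) \<in> \<A>"
        using \<K> by (cases k) (auto simp: compact_pieces_def)
      show "\<exists>\<delta>>0. \<forall>\<^sub>F q in nhds p. P k q \<delta>"
      proof (cases "p \<in> K")
        case False
        then have "\<forall>\<^sub>F q in nhds p. q \<in> - K"
          using k(2) by (intro eventually_nhds_in_open) (auto simp: compact_imp_closed)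
        then show ?thesis by (intro exI[of _ 1]) (auto simp: k P_def elim: eventually_mono)
      next
        case True
        define G where "G = \<psi> \<circ> f \<circ> inv_into U \<phi>"
        have "smooth_on (\<phi> ` (U \<inter> f -` V)) G"
          using f k V by (fastforce simp: smooth_map_def G_def)
        then have CG: "Ck_on (Suc 0) (\<phi> ` (U \<inter> f -` V)) G" by (simp add: smooth_on_def del: Ck_on.simps)
        have Gp: "G (\<phi> q) = \<psi> (f q)" if "q \<in> U" for q
          using chart_inj[OF atlas k(4)] that by (simp add: G_def)
        have "open (f -` V)" "open (f -` interior J)"
          using contf chart_open[OF atlas V(2)] by (auto intro: open_vimage)
        then have op: "open (\<phi> ` (U \<inter> f -` V))" "open (\<phi> ` (U \<inter> f -` interior J))"
          using chart_image_open[OF atlas k(4)] by auto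
        have mem: "\<phi> p \<in> \<phi> ` (U \<inter> f -` V)" "\<phi> p \<in> \<phi> ` (U \<inter> f -` interior J)"
          using True k J V interior_subset by blast+
        obtain r1 L where r1: "r1 > 0"
          "\<And>y z. y \<in> ball (\<phi> p) r1 \<Longrightarrow> z \<in> ball (\<phi> p) r1 \<Longrightarrow> norm (G y - G z) \<le> L * norm (y - z)"
          using C1_imp_locally_lipschitz[OF B op(1) mem(1) CG] by metis
        obtain r2 where r2: "r2 > 0" "ball (\<phi> p) r2 \<subseteq> \<phi> ` (U \<inter> f -` interior J)"
          using op(2) mem(2) by (meson open_contains_ball)
        define r where "r = min r1 r2"
        define \<delta> where "\<delta> = min (r / 2) (1 / (\<bar>L\<bar> + 1))"
        have r: "r > 0" using r1 r2 by (simp add: r_def)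
        then have \<delta>: "\<delta> > 0" "\<delta> \<le> r / 2" "\<delta> \<le> 1 / (\<bar>L\<bar> + 1)"  by (auto simp: \<delta>_def)
        have "1 / (1 / (\<bar>L\<bar> + 1)) \<le> 1 / \<delta>" using \<delta>(1,3) by (intro frac_le) auto
        then have L: "L \<le> 1 / \<delta>" by simp
        have "\<forall>\<^sub>F q in nhds p. norm (\<phi> q - \<phi> p) < r / 2"
          using True k(3) r by (intro chart_eventually_near[OF atlas k(4)]) auto
        then have "\<forall>\<^sub>F q in nhds p. P k q \<delta>"
        proof (rule eventually_mono, unfold P_def, intro allI impI)
          fix q q' \<epsilon> assume *: "norm (\<phi> q - \<phi> p) < r / 2"
            "\<epsilon> \<le> \<delta> \<and> q \<in> fst k \<and> q' \<in> fst k \<and> norm (snd k q - snd k q') \<le> \<epsilon>"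
          then have **: "q \<in> K" "q' \<in> K" "norm (\<phi> q - \<phi> q') \<le> \<epsilon>" "\<epsilon> \<le> \<delta>" by (auto simp: k)
          have d: "dist (\<phi> p) (\<phi> q') < r" "dist (\<phi> p) (\<phi> q) < r"
            using * ** \<delta>(2) r dist_triangle[of "\<phi> p" "\<phi> q'" "\<phi> q"]
            by (auto simp: dist_norm norm_minus_commute)
          then have "\<phi> q' \<in> \<phi> ` (U \<inter> f -` interior J)" "\<phi> q \<in> \<phi> ` (U \<inter> f -` interior J)"
            using r2 by (auto simp: r_def)
          then have "f q \<in> interior J" "f q' \<in> interior J"
            using chart_inj[OF atlas k(4)] ** k(3) by (auto simp: inj_on_def)
          then have inJ: "f q \<in> J" "f q' \<in> J" using interior_subset by blast+
          have "norm (G (\<phi> q) - G (\<phi> q')) \<le> L * norm (\<phi> q - \<phi> q')"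
            using d by (intro r1) (auto simp: r_def)
          also have "\<dots> \<le> (1 / \<delta>) * norm (\<phi> q - \<phi> q')" using L by (rule mult_right_mono) simp
          also have "\<dots> \<le> (1 / \<delta>) * \<epsilon>" using ** \<delta> by (intro mult_left_mono) auto
          finally have "norm (G (\<phi> q) - G (\<phi> q')) \<le> \<epsilon> / \<delta>" by simp
          moreover have "q \<in> U" "q' \<in> U" using ** k(3) by auto
          ultimately have "norm (\<psi> (f q) - \<psi> (f q')) \<le> \<epsilon> / \<delta>" by (simp add: Gp)
          then show "near \<K> (\<epsilon> / \<delta>) (f q) (f q')" using J inJ by (auto simp: near_def)
        qed
        then show ?thesis using \<delta> by blast
      qed
    qed (auto elim!: eventually_mono intro: Pmono)
    then show "\<exists>\<delta>>0. \<forall>\<^sub>F q in nhds p. \<forall>k\<in>\<K>. P k q \<delta>"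
      using \<K> by (auto intro!: eventually_ball_finite simp: compact_pieces_def)
  qed (auto intro: Pmono)
  then obtain \<delta> where \<delta>: "\<delta> > 0" "\<forall>q. \<forall>k\<in>\<K>. P k q \<delta>" by blast
  show ?thesis
  proof (rule that[OF \<delta>(1)])
    fix \<epsilon> p q assume "\<epsilon> \<le> \<delta>" "near \<K> \<epsilon> p q"
    then obtain K \<phi> where "(K, \<phi>) \<in> \<K>" "p \<in> K" "q \<in> K" "norm (\<phi> p - \<phi> q) \<le> \<epsilon>"
      by (auto simp: near_def)
    then show "near \<K> (\<epsilon> / \<delta>) (f p) (f q)"
      using \<delta>(2) \<open>\<epsilon> \<le> \<delta>\<close> unfolding P_def by fastforce
  qed
qed

text \<open>
  The coordinate image of a piece is compact, hence bounded; the cells are the preimages, within each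
  piece, of the cells that cover its image.
\<close>

lemma near_cells_cover:
  fixes \<A> :: "('m::t2_space, 'e::real_inner) chart set"
  assumes atlas: "smooth_atlas \<A>" and \<K>: "compact_pieces \<A> \<K>"
  obtains k D where "\<And>\<epsilon>. 0 < \<epsilon> \<Longrightarrow> \<epsilon> \<le> 1 \<Longrightarrow> \<exists>\<P>. finite \<P> \<and> \<Union>\<P> = UNIV \<and>
      real (card \<P>) \<le> k * (1 / \<epsilon>) ^ D \<and> (\<forall>P\<in>\<P>. \<forall>p\<in>P. \<forall>q\<in>P. near \<K> \<epsilon> p q)"
proof -
  obtain B :: "'e set" where B: "finite B" "span B = UNIV"
    using atlas by (auto simp: smooth_atlas_def)
  obtain C :: "'e set" where C: "finite C" "\<And>c. c \<in> C \<Longrightarrow> norm c = 1"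
    "\<And>x. (\<Sum>c\<in>C. (x \<bullet> c) *\<^sub>R c) = x"
    using orthonormal_basis_exists[OF B] by blast
  have fin: "finite \<K>" using \<K> by (simp add: compact_pieces_def)
  have "\<exists>k. \<forall>\<epsilon>. 0 < \<epsilon> \<and> \<epsilon> \<le> 1 \<longrightarrow> (\<exists>\<P>. finite \<P> \<and> snd K ` fst K \<subseteq> \<Union>\<P> \<and>
      real (card \<P>) \<le> k * (1 / \<epsilon>) ^ card C \<and>
      (\<forall>P\<in>\<P>. \<forall>x\<in>P. \<forall>y\<in>P. norm (x - y) \<le> \<epsilon>))" if K: "K \<in> \<K>" for K
  proof -
    obtain U where "compact (fst K)" "fst K \<subseteq> U" "(U, snd K) \<in> \<A>"
      using \<K> K by (cases K) (auto simp: compact_pieces_def)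
    then have "compact (snd K ` fst K)"
      using chart_cont[OF atlas] continuous_on_subset compact_continuous_image by blast
    then have "bounded (snd K ` fst K)" by (rule compact_imp_bounded)
    from small_cells_cover[OF C this] show ?thesis by metis
  qed
  then obtain k where k: "\<And>K \<epsilon>. K \<in> \<K> \<Longrightarrow> 0 < \<epsilon> \<Longrightarrow> \<epsilon> \<le> 1 \<Longrightarrow>
      (\<exists>\<P>. finite \<P> \<and> snd K ` fst K \<subseteq> \<Union>\<P> \<and> real (card \<P>) \<le> k K * (1 / \<epsilon>) ^ card C \<and>
      (\<forall>P\<in>\<P>. \<forall>x\<in>P. \<forall>y\<in>P. norm (x - y) \<le> \<epsilon>))" by metis
  show ?thesis
  proof (rule that[of "\<Sum>K\<in>\<K>. k K" "card C"])
    fix \<epsilon> :: real assume \<epsilon>: "0 < \<epsilon>" "\<epsilon> \<le> 1"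
    define good where "good = (\<lambda>K \<P>. finite \<P> \<and> snd K ` fst K \<subseteq> \<Union>\<P> \<and>
      real (card \<P>) \<le> k K * (1 / \<epsilon>) ^ card C \<and> (\<forall>P\<in>\<P>. \<forall>x\<in>P. \<forall>y\<in>P. norm (x - y) \<le> \<epsilon>))"
    have "\<forall>K\<in>\<K>. \<exists>\<P>. good K \<P>"
      unfolding good_def using k[OF _ \<epsilon>] by (rule ballI)
    then obtain \<P> where good: "\<And>K. K \<in> \<K> \<Longrightarrow> good K (\<P> K)" by metis
    have \<P>: "finite (\<P> K)" "snd K ` fst K \<subseteq> \<Union>(\<P> K)"
      "real (card (\<P> K)) \<le> k K * (1 / \<epsilon>) ^ card C"
      "\<And>P x y. P \<in> \<P> K \<Longrightarrow> x \<in> P \<Longrightarrow> y \<in> P \<Longrightarrow> norm (x - y) \<le> \<epsilon>" if "K \<in> \<K>" for K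
      using good[OF that] by (auto simp: good_def)
    define \<Q> where "\<Q> = (\<Union>K\<in>\<K>. (\<lambda>P. fst K \<inter> snd K -` P) ` \<P> K)"
    show "\<exists>\<P>. finite \<P> \<and> \<Union>\<P> = UNIV \<and> real (card \<P>) \<le> (\<Sum>K\<in>\<K>. k K) * (1 / \<epsilon>) ^ card C \<and>
      (\<forall>P\<in>\<P>. \<forall>p\<in>P. \<forall>q\<in>P. near \<K> \<epsilon> p q)"
    proof (intro exI conjI ballI)
      show "finite \<Q>" using fin \<P> by (simp add: \<Q>_def)
      show "\<Union>\<Q> = UNIV"
      proof -
        have "p \<in> \<Union>\<Q>" for p
        proof -
          have "p \<in> (\<Union>(K, \<phi>)\<in>\<K>. interior K)" using \<K> by (simp add: compact_pieces_def)
          then obtain K where K: "K \<in> \<K>" "p \<in> interior (fst K)" by (auto simp: case_prod_beta)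
          then have "p \<in> fst K" using interior_subset by blast
          then obtain P where "P \<in> \<P> K" "snd K p \<in> P" using \<P>(2)[OF K(1)] by blast
          then show ?thesis using K(1) \<open>p \<in> fst K\<close> by (auto simp: \<Q>_def)
        qed
        then show ?thesis by auto
      qed
      have "card \<Q> \<le> (\<Sum>K\<in>\<K>. card ((\<lambda>P. fst K \<inter> snd K -` P) ` \<P> K))"
        unfolding \<Q>_def using fin by (rule card_UN_le)
      also have "\<dots> \<le> (\<Sum>K\<in>\<K>. card (\<P> K))"
        using \<P>(1) by (intro sum_mono card_image_le)
      finally have "real (card \<Q>) \<le> (\<Sum>K\<in>\<K>. real (card (\<P> K)))" by (simp flip: of_nat_sum)
      also have "\<dots> \<le> (\<Sum>K\<in>\<K>. k K * (1 / \<epsilon>) ^ card C)" using \<P>(3) by (rule sum_mono)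
      finally show "real (card \<Q>) \<le> (\<Sum>K\<in>\<K>. k K) * (1 / \<epsilon>) ^ card C"
        by (simp only: sum_distrib_right)
      fix Q p q assume "Q \<in> \<Q>" "p \<in> Q" "q \<in> Q"
      then obtain K P where "K \<in> \<K>" "P \<in> \<P> K" "p \<in> fst K" "q \<in> fst K" "snd K p \<in> P" "snd K q \<in> P"
        by (auto simp: \<Q>_def)
      then show "near \<K> \<epsilon> p q"
        unfolding near_def by (intro bexI[of _ K]) (auto simp: case_prod_beta \<P>(4))
    qed
  qed
qed

section \<open>Subexponential stretching and entropy\<close>

text \<open>
  In \<open>stretches \<K> L r k f\<close> the number \<open>k\<close> plays the role of the word length of \<open>f\<close> in generators
  that are Lipschitz with constant \<open>L\<close> below the scale \<open>r\<close>.  The estimate is required only as long as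
  the image scale does not exceed \<open>r\<close>, which is what makes it stable under composition: the lengths
  add up and \<open>L\<close> and \<open>r\<close> stay the same.
\<close>

definition stretches ::
  "('m, 'e::real_normed_vector) chart set \<Rightarrow> real \<Rightarrow> real \<Rightarrow> nat \<Rightarrow> ('m \<Rightarrow> 'm) \<Rightarrow> bool" where
  "stretches \<K> L r k f \<longleftrightarrow>
     (\<forall>\<epsilon> p q. 0 \<le> \<epsilon> \<and> L ^ k * \<epsilon> \<le> r \<and> near \<K> \<epsilon> p q \<longrightarrow> near \<K> (L ^ k * \<epsilon>) (f p) (f q))"

lemma stretchesD:
  assumes "stretches \<K> L r k f" "0 \<le> \<epsilon>" "L ^ k * \<epsilon> \<le> r" "near \<K> \<epsilon> p q"
  shows "near \<K> (L ^ k * \<epsilon>) (f p) (f q)"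
  using assms unfolding stretches_def by blast

lemma stretches_comp:
  assumes "L \<ge> 1" "stretches \<K> L r k f" "stretches \<K> L r l g"
  shows "stretches \<K> L r (k + l) (f \<circ> g)"
  unfolding stretches_def
proof (intro allI impI)
  fix \<epsilon> p q assume *: "0 \<le> \<epsilon> \<and> L ^ (k + l) * \<epsilon> \<le> r \<and> near \<K> \<epsilon> p q"
  have "1 * (L ^ l * \<epsilon>) \<le> L ^ k * (L ^ l * \<epsilon>)"
    using assms(1) * by (intro mult_right_mono) auto
  also have "\<dots> \<le> r" using * by (simp add: power_add mult.assoc)
  finally have "near \<K> (L ^ l * \<epsilon>) (g p) (g q)" using assms(3) * by (simp add: stretches_def)
  then show "near \<K> (L ^ (k + l) * \<epsilon>) ((f \<circ> g) p) ((f \<circ> g) q)"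
    using assms(1,2) * by (simp add: stretches_def power_add mult.assoc)
qed

lemma stretches_mono:
  assumes "L \<ge> 1" "stretches \<K> L r k f" "k \<le> l"
  shows "stretches \<K> L r l f"
  unfolding stretches_def
proof (intro allI impI)
  fix \<epsilon> p q assume *: "0 \<le> \<epsilon> \<and> L ^ l * \<epsilon> \<le> r \<and> near \<K> \<epsilon> p q"
  have le: "L ^ k * \<epsilon> \<le> L ^ l * \<epsilon>"
    using assms * by (intro mult_right_mono power_increasing) auto
  then have "near \<K> (L ^ k * \<epsilon>) (f p) (f q)" using assms(2) * by (simp add: stretches_def)
  then show "near \<K> (L ^ l * \<epsilon>) (f p) (f q)" using le by (rule near_mono)
qed

lemma stretches_funpow:
  assumes "L \<ge> 1" "stretches \<K> L r 1 f"
  shows "stretches \<K> L r n (f ^^ n)"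
proof (induction n)
  case 0
  show ?case by (simp add: stretches_def)
next
  case (Suc n)
  show ?case using stretches_comp[OF assms Suc] by (simp only: funpow.simps plus_1_eq_Suc)
qed

lemma smooth_maps_stretch:
  fixes \<A> :: "('m::t2_space, 'e::real_inner) chart set"
  assumes cpt: "compact (UNIV :: 'm set)" and atlas: "smooth_atlas \<A>"
    and \<K>: "compact_pieces \<A> \<K>" and F: "finite F" "\<And>f. f \<in> F \<Longrightarrow> smooth_map \<A> f"
  obtains L r where "L \<ge> 1" "r > 0" "\<And>f. f \<in> F \<Longrightarrow> stretches \<K> L r 1 f"
proof -
  have "\<exists>\<delta>>0. \<forall>f\<in>F. \<forall>\<epsilon> p q. 0 \<le> \<epsilon> \<and> \<epsilon> \<le> \<delta> \<and> near \<K> \<epsilon> p q \<longrightarrow> near \<K> (\<epsilon> / \<delta>) (f p) (f q)"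
  proof (rule uniform_scale_finite[OF F(1)])
    fix f assume "f \<in> F"
    then have "smooth_map \<A> f" by (rule F(2))
    note lip = near_lipschitz[OF cpt atlas \<K> this]
    show "\<exists>\<delta>>0. \<forall>\<epsilon> p q. 0 \<le> \<epsilon> \<and> \<epsilon> \<le> \<delta> \<and> near \<K> \<epsilon> p q \<longrightarrow> near \<K> (\<epsilon> / \<delta>) (f p) (f q)"
    proof (rule lip)
      fix \<delta> :: real assume "\<delta> > 0"
        "\<And>\<epsilon> p q. \<epsilon> \<le> \<delta> \<Longrightarrow> near \<K> \<epsilon> p q \<Longrightarrow> near \<K> (\<epsilon> / \<delta>) (f p) (f q)"
      then show ?thesis by (intro exI[of _ \<delta>]) simp
    qed
  next
    fix f :: "'m \<Rightarrow> 'm" and \<delta> \<delta>' :: real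
    assume *: "\<forall>\<epsilon> p q. 0 \<le> \<epsilon> \<and> \<epsilon> \<le> \<delta> \<and> near \<K> \<epsilon> p q \<longrightarrow> near \<K> (\<epsilon> / \<delta>) (f p) (f q)"
      "0 < \<delta>'" "\<delta>' \<le> \<delta>"
    show "\<forall>\<epsilon> p q. 0 \<le> \<epsilon> \<and> \<epsilon> \<le> \<delta>' \<and> near \<K> \<epsilon> p q \<longrightarrow> near \<K> (\<epsilon> / \<delta>') (f p) (f q)"
    proof (intro allI impI)
      fix \<epsilon> p q assume **: "0 \<le> \<epsilon> \<and> \<epsilon> \<le> \<delta>' \<and> near \<K> \<epsilon> p q"
      then have "\<epsilon> / \<delta> \<le> \<epsilon> / \<delta>'" using * by (simp add: frac_le)
      moreover have "near \<K> (\<epsilon> / \<delta>) (f p) (f q)" using *(1,3) ** by simp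
      ultimately show "near \<K> (\<epsilon> / \<delta>') (f p) (f q)" by (rule near_mono[rotated])
    qed
  qed
  then obtain \<delta> where \<delta>0: "\<delta> > 0" and lip:
    "\<forall>f\<in>F. \<forall>\<epsilon> p q. 0 \<le> \<epsilon> \<and> \<epsilon> \<le> \<delta> \<and> near \<K> \<epsilon> p q \<longrightarrow> near \<K> (\<epsilon> / \<delta>) (f p) (f q)"
    by (elim exE conjE)
  define L where "L = max 1 (1 / \<delta>)"
  show ?thesis
  proof
    show L: "L \<ge> 1" by (simp add: L_def)
    show "\<delta> > 0" by (fact \<delta>0)
    fix f assume f: "f \<in> F"
    show "stretches \<K> L \<delta> 1 f"
      unfolding stretches_def
    proof (intro allI impI)
      fix \<epsilon> p q assume *: "0 \<le> \<epsilon> \<and> L ^ 1 * \<epsilon> \<le> \<delta> \<and> near \<K> \<epsilon> p q"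
      have "1 * \<epsilon> \<le> L * \<epsilon>" using L * by (intro mult_right_mono) auto
      then have "near \<K> (\<epsilon> / \<delta>) (f p) (f q)" using bspec[OF lip f] * by simp
      moreover have "(1 / \<delta>) * \<epsilon> \<le> L * \<epsilon>" using * by (intro mult_right_mono) (auto simp: L_def)
      ultimately show "near \<K> (L ^ 1 * \<epsilon>) (f p) (f q)" by (auto intro: near_mono)
    qed
  qed
qed

text \<open>
  A finite cover that refines \<open>\<W>\<close> bounds the size of subcovers of \<open>\<W>\<close>: enlarge each set of the
  refinement to a member of \<open>\<W>\<close>.
\<close>

lemma min_subcover_card_le:
  assumes "finite \<P>" "\<Union>\<P> = UNIV" "\<And>P. P \<in> \<P> \<Longrightarrow> \<exists>W\<in>\<W>. P \<subseteq> W"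
  shows "min_subcover_card \<W> \<le> card \<P>"
proof -
  obtain W where W: "\<And>P. P \<in> \<P> \<Longrightarrow> W P \<in> \<W>" "\<And>P. P \<in> \<P> \<Longrightarrow> P \<subseteq> W P"
    using assms(3) by metis
  have "W ` \<P> \<subseteq> \<W> \<and> finite (W ` \<P>) \<and> card (W ` \<P>) = card (W ` \<P>) \<and> \<Union>(W ` \<P>) = UNIV"
    using assms(1,2) W by blast
  then have "min_subcover_card \<W> \<le> card (W ` \<P>)"
    unfolding min_subcover_card_def by (intro Least_le) blast
  also have "\<dots> \<le> card \<P>" using assms(1) by (rule card_image_le)
  finally show ?thesis .
qed

text \<open>
  If the first \<open>n\<close> iterates stretch distances at most by \<open>L\<close> to the power \<open>len n\<close>, a set of diameter
  \<open>s\<close> divided by this factor stays of diameter \<open>s\<close> under all of them, and so it lies in one member of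
  the iterated join if \<open>s\<close> is a Lebesgue number.  The number of such sets needed to cover the manifold
  has a logarithm that is affine in \<open>len n\<close>, hence \<open>o(n)\<close>.
\<close>

lemma zero_entropy_of_sublinear_stretching:
  fixes \<A> :: "('m::t2_space, 'e::real_inner) chart set"
  assumes cpt: "compact (UNIV :: 'm set)" and atlas: "smooth_atlas \<A>"
    and \<K>: "compact_pieces \<A> \<K>" and L: "L \<ge> 1" and r: "r > 0"
    and len: "(\<lambda>n. real (len n) / real n) \<longlonglongrightarrow> 0"
    and h: "\<And>n j. j < n \<Longrightarrow> stretches \<K> L r (len n) (h ^^ j)"
  shows "topological_entropy h = 0"
proof -
  have entropy0: "cover_entropy h \<U> = 0" if \<U>: "open_cover \<U>" for \<U>
  proof -
    obtain \<delta> where \<delta>: "\<delta> > 0" "\<And>p. \<exists>U\<in>\<U>. \<forall>q. near \<K> \<delta> p q \<longrightarrow> q \<in> U"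
      using near_lebesgue_number[OF cpt atlas \<K> \<U>] by metis
    obtain k D where kD: "\<And>\<epsilon>. 0 < \<epsilon> \<Longrightarrow> \<epsilon> \<le> 1 \<Longrightarrow> \<exists>\<P>. finite \<P> \<and> \<Union>\<P> = UNIV \<and>
      real (card \<P>) \<le> k * (1 / \<epsilon>) ^ D \<and> (\<forall>P\<in>\<P>. \<forall>p\<in>P. \<forall>q\<in>P. near \<K> \<epsilon> p q)"
      using near_cells_cover[OF atlas \<K>] by metis
    define s where "s = min 1 (min \<delta> r)"
    have s: "0 < s" "s \<le> 1" "s \<le> \<delta>" "s \<le> r" using \<delta> r by (auto simp: s_def)
    define N where "N = (\<lambda>n. real (min_subcover_card (iterated_join h n \<U>)))"
    have N: "N n \<le> k * (L ^ len n / s) ^ D" for n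
    proof -
      define \<epsilon> where "\<epsilon> = s / L ^ len n"
      have "L ^ len n \<ge> 1" "L \<noteq> 0" "L ^ len n > 0" using L by auto
      then have \<epsilon>: "0 < \<epsilon>" "\<epsilon> \<le> 1" "L ^ len n * \<epsilon> = s"
        using s order_trans[OF s(2)] by (simp_all add: \<epsilon>_def pos_divide_le_eq)
      obtain \<P> where \<P>: "finite \<P>" "\<Union>\<P> = UNIV" "real (card \<P>) \<le> k * (1 / \<epsilon>) ^ D"
        "\<forall>P\<in>\<P>. \<forall>p\<in>P. \<forall>q\<in>P. near \<K> \<epsilon> p q"
        using kD[OF \<epsilon>(1,2)] by (elim exE conjE)
      have "\<exists>W\<in>iterated_join h n \<U>. P \<subseteq> W" if P: "P \<in> \<P>" for P
      proof -
        \<comment> \<open>Follow the orbit of one point of \<open>P\<close> and choose the member of \<open>\<U>\<close> around each orbit point.\<close>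
        obtain U where U: "\<And>p. U p \<in> \<U>" "\<And>p q. near \<K> \<delta> p q \<Longrightarrow> q \<in> U p"
          using \<delta>(2) by metis
        define p where "p = (SOME p. p \<in> P)"
        have "P \<subseteq> (\<Inter>i<n. (h ^^ i) -` U ((h ^^ i) p))"
        proof (intro subsetI INT_I vimageI2)
          fix q i assume q: "q \<in> P" and i: "i \<in> {..<n}"
          have "p \<in> P" using q unfolding p_def by (rule someI)
          then have "near \<K> \<epsilon> p q" using \<P>(4) P q by blast
          then have "near \<K> (L ^ len n * \<epsilon>) ((h ^^ i) p) ((h ^^ i) q)"
            using h[of i n] i \<epsilon>(1) s(4) \<epsilon>(3) by (intro stretchesD[of _ _ r]) simp_all
          then have "near \<K> s ((h ^^ i) p) ((h ^^ i) q)" by (simp only: \<epsilon>(3))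
          then show "(h ^^ i) q \<in> U ((h ^^ i) p)" by (rule U(2)[OF near_mono[OF _ s(3)]])
        qed
        moreover have "(\<Inter>i<n. (h ^^ i) -` U ((h ^^ i) p)) \<in> iterated_join h n \<U>"
          using U(1) by (auto simp: iterated_join_def)
        ultimately show ?thesis by blast
      qed
      then have "N n \<le> real (card \<P>)"
        unfolding N_def using min_subcover_card_le[OF \<P>(1,2)] by simp
      also have "\<dots> \<le> k * (L ^ len n / s) ^ D" using \<P>(3) by (simp add: \<epsilon>_def)
      finally show ?thesis .
    qed
    \<comment> \<open>The factor \<open>max k 1\<close> is positive, so that the logarithm of the product splits, and its logarithm
        is non-negative, so that the bound covers the value \<open>ln 0 = 0\<close> too.\<close>
    have lnN: "ln (N n) \<le> ln (max k 1) + real D * (real (len n) * ln L - ln s)" for n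
    proof (cases "N n = 0")
      case True
      have "ln s \<le> 0" "ln L \<ge> 0" "ln (max k 1) \<ge> 0" using s L by auto
      then have "0 \<le> real (len n) * ln L - ln s"
        using mult_nonneg_nonneg[of "real (len n)" "ln L"] by linarith
      then show ?thesis using True \<open>ln (max k 1) \<ge> 0\<close> by simp
    next
      case False
      then have pos: "N n > 0" by (simp add: N_def)
      have "max k 1 \<noteq> 0" by (auto simp: max_def)
      have "N n \<le> max k 1 * (L ^ len n / s) ^ D"
        by (rule order_trans[OF N mult_right_mono]) (use L s in auto)
      then have "ln (N n) \<le> ln (max k 1 * (L ^ len n / s) ^ D)" using pos by simp
      also have "\<dots> = ln (max k 1) + real D * (real (len n) * ln L - ln s)"
        using L s \<open>max k 1 \<noteq> 0\<close> by (simp add: ln_mult ln_realpow ln_div)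
      finally show ?thesis .
    qed
    have "(\<lambda>n. (ln (max k 1) - real D * ln s) * (1 / real n) + real D * ln L * (real (len n) / real n))
        \<longlonglongrightarrow> (ln (max k 1) - real D * ln s) * 0 + real D * ln L * 0"
      by (intro tendsto_intros len lim_1_over_n)
    then have upper: "(\<lambda>n. (ln (max k 1) - real D * ln s) * (1 / real n) +
        real D * ln L * (real (len n) / real n)) \<longlonglongrightarrow> 0" by simp
    have "(\<lambda>n. ln (N n) / real n) \<longlonglongrightarrow> 0"
    proof (rule tendsto_sandwich[OF _ _ tendsto_const upper])
      have "ln (N n) \<ge> 0" for n by (cases "N n = 0") (auto simp: N_def)
      then show "\<forall>\<^sub>F n in sequentially. 0 \<le> ln (N n) / real n" by simp
      have "ln (N n) / real n \<le> (ln (max k 1) - real D * ln s) * (1 / real n) +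
        real D * ln L * (real (len n) / real n)" for n
        using divide_right_mono[OF lnN, of "real n" n]
        by (simp add: algebra_simps add_divide_distrib diff_divide_distrib)
      then show "\<forall>\<^sub>F n in sequentially. ln (N n) / real n \<le>
        (ln (max k 1) - real D * ln s) * (1 / real n) + real D * ln L * (real (len n) / real n)" by simp
    qed
    then have "(\<lambda>n. ereal (ln (N n) / real n)) \<longlonglongrightarrow> ereal 0" by (rule tendsto_ereal)
    then show ?thesis
      unfolding cover_entropy_def N_def by (simp add: lim_imp_Limsup zero_ereal_def)
  qed
  have "open_cover {UNIV :: 'm set}" by (simp add: open_cover_def)
  then show ?thesis
    unfolding topological_entropy_def by (auto simp: entropy0 intro!: SUP_eq_const)
qed

section \<open>The central element of a Heisenberg action\<close>

lemma funpow_comp_commute: "f \<circ> g = g \<circ> f \<Longrightarrow> f ^^ n \<circ> g = g \<circ> f ^^ n"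
  by (induction n) (auto simp: fun_eq_iff)

lemma funpow_left_inverse:
  fixes f f' :: "'a \<Rightarrow> 'a"
  assumes "f' \<circ> f = id"
  shows "f' ^^ n \<circ> f ^^ n = id"
proof (induction n)
  case (Suc n)
  have "f' ^^ Suc n \<circ> f ^^ Suc n = f' ^^ n \<circ> (f' \<circ> f) \<circ> f ^^ n"
    unfolding funpow_Suc_right[of n f'] funpow.simps(2)[of n f] by (simp only: comp_assoc)
  then show ?case by (simp only: assms comp_id Suc)
qed simp

text \<open>
  Moving one \<open>b\<close> to the left past \<open>m\<close> copies of \<open>a\<close> releases one central \<open>c\<close> for each of them.
\<close>

lemma heisenberg_commutator:
  assumes "a \<circ> c = c \<circ> a" "b \<circ> c = c \<circ> b" "a \<circ> b = b \<circ> a \<circ> c"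
    and "a' \<circ> a = id" "b' \<circ> b = id"
  shows "c ^^ (m * n) = a' ^^ m \<circ> b' ^^ n \<circ> a ^^ m \<circ> b ^^ n"
proof -
  have one: "a ^^ m \<circ> b = b \<circ> a ^^ m \<circ> c ^^ m" for m
  proof (induction m)
    case (Suc m)
    have "a ^^ Suc m \<circ> b = a \<circ> (a ^^ m \<circ> b)" by (simp only: funpow.simps comp_assoc)
    also have "\<dots> = (a \<circ> b) \<circ> (a ^^ m \<circ> c ^^ m)" by (simp only: Suc comp_assoc)
    also have "\<dots> = b \<circ> a \<circ> (c \<circ> a ^^ m) \<circ> c ^^ m" unfolding assms(3) by (simp only: comp_assoc)
    also have "\<dots> = b \<circ> a \<circ> (a ^^ m \<circ> c) \<circ> c ^^ m"
      by (simp only: funpow_comp_commute[OF assms(1)])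
    also have "\<dots> = b \<circ> a ^^ Suc m \<circ> c ^^ Suc m" by (simp only: funpow.simps comp_assoc)
    finally show ?case .
  qed simp
  have "a ^^ m \<circ> b ^^ n = b ^^ n \<circ> a ^^ m \<circ> c ^^ (m * n)"
  proof (induction n)
    case (Suc n)
    have cb: "c ^^ k \<circ> b = b \<circ> c ^^ k" for k
      using funpow_comp_commute[of c b k] assms(2) by simp
    have "a ^^ m \<circ> b ^^ Suc n = (a ^^ m \<circ> b ^^ n) \<circ> b" by (simp only: funpow_Suc_right comp_assoc)
    also have "\<dots> = b ^^ n \<circ> a ^^ m \<circ> (c ^^ (m * n) \<circ> b)" by (simp only: Suc comp_assoc)
    also have "\<dots> = b ^^ n \<circ> (a ^^ m \<circ> b) \<circ> c ^^ (m * n)" by (simp only: cb comp_assoc)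
    also have "\<dots> = (b ^^ n \<circ> b) \<circ> a ^^ m \<circ> (c ^^ m \<circ> c ^^ (m * n))" by (simp only: one comp_assoc)
    also have "\<dots> = b ^^ Suc n \<circ> a ^^ m \<circ> c ^^ (m * Suc n)"
      by (simp only: funpow_Suc_right funpow_add[symmetric] mult_Suc_right)
    finally show ?case .
  qed simp
  then have "a' ^^ m \<circ> b' ^^ n \<circ> a ^^ m \<circ> b ^^ n = a' ^^ m \<circ> (b' ^^ n \<circ> b ^^ n) \<circ> a ^^ m \<circ> c ^^ (m * n)"
    by (simp add: comp_assoc)
  also have "\<dots> = c ^^ (m * n)"
    by (simp add: funpow_left_inverse assms)
  finally show ?thesis ..
qed

text \<open>
  Division with remainder, \<open>j = q n + (j mod n)\<close>, writes \<open>c ^^ j\<close> as a commutator of powers with exponents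
  \<open>q \<le> n\<close> and \<open>n\<close>, times fewer than \<open>n\<close> further copies of \<open>c\<close>.
\<close>

lemma funpow_central_stretches:
  assumes L: "L \<ge> 1" and rel: "a \<circ> c = c \<circ> a" "b \<circ> c = c \<circ> b" "a \<circ> b = b \<circ> a \<circ> c"
    "a' \<circ> a = id" "b' \<circ> b = id"
    and st: "\<And>f. f \<in> {a, a', b, b', c} \<Longrightarrow> stretches \<K> L r 1 f"
    and j: "j < n * n"
  shows "stretches \<K> L r (5 * n) (c ^^ j)"
proof -
  define q where "q = j div n"
  have q: "q \<le> n" using j by (simp add: q_def less_mult_imp_div_less less_imp_le)
  have m: "j mod n \<le> n" using j by (cases n) (auto intro: less_imp_le)
  have "c ^^ j = c ^^ (q * n + j mod n)" by (simp add: q_def)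
  also have "\<dots> = a' ^^ q \<circ> b' ^^ n \<circ> a ^^ q \<circ> b ^^ n \<circ> c ^^ (j mod n)"
    by (simp only: funpow_add heisenberg_commutator[OF rel])
  finally have eq: "c ^^ j = a' ^^ q \<circ> b' ^^ n \<circ> a ^^ q \<circ> b ^^ n \<circ> c ^^ (j mod n)" .
  have "stretches \<K> L r (q + n + q + n + j mod n) (c ^^ j)"
    unfolding eq by (intro stretches_comp stretches_funpow L st) auto
  then show ?thesis by (rule stretches_mono[OF L]) (use q m in simp)
qed

lemma heisenberg_action_relations:
  assumes "\<alpha> \<in> hom Heisenberg (Diff \<A>)"
    and w_def: "\<And>x e. w x e = \<alpha> (heisenberg_class [(x, e)])"
  shows "w Gen_A True \<circ> w Gen_C True = w Gen_C True \<circ> w Gen_A True"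
    and "w Gen_B True \<circ> w Gen_C True = w Gen_C True \<circ> w Gen_B True"
    and "w Gen_A True \<circ> w Gen_B True = w Gen_B True \<circ> w Gen_A True \<circ> w Gen_C True"
    and "w x False \<circ> w x True = id"
    and "diffeomorphism \<A> (w x e)"
proof -
  have carrier: "heisenberg_class u \<in> carrier Heisenberg" for u by (simp add: Heisenberg_def)
  have mult: "\<alpha> (heisenberg_class (u @ v)) = \<alpha> (heisenberg_class u) \<circ> \<alpha> (heisenberg_class v)" for u v
    using hom_mult[OF assms(1) carrier carrier, of u v] by (simp add: heisenberg_mult_class Diff_def)
  have diffeo: "diffeomorphism \<A> (\<alpha> (heisenberg_class u))" for u
    using hom_in_carrier[OF assms(1) carrier, of u] by (simp add: Diff_def)
  have eq: "\<alpha> (heisenberg_class u) = \<alpha> (heisenberg_class v)" if "heisenberg_eq u v" for u v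
    using that by (simp add: heisenberg_class_eq_iff[symmetric])
  have "inj (\<alpha> (heisenberg_class []))" using diffeo by (simp add: diffeomorphism_def bij_is_inj)
  \<comment> \<open>The image of the neutral element is idempotent, and an injective idempotent map is the identity.\<close>
  then have one: "\<alpha> (heisenberg_class []) = id"
    using mult[of "[]" "[]"] by (auto simp: fun_eq_iff inj_def)
  show "w Gen_A True \<circ> w Gen_C True = w Gen_C True \<circ> w Gen_A True"
    using eq[OF heq_AC] mult[of "[_]" "[_]"] by (simp add: w_def)
  show "w Gen_B True \<circ> w Gen_C True = w Gen_C True \<circ> w Gen_B True"
    using eq[OF heq_BC] mult[of "[_]" "[_]"] by (simp add: w_def)
  show "w Gen_A True \<circ> w Gen_B True = w Gen_B True \<circ> w Gen_A True \<circ> w Gen_C True"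
    using eq[OF heq_AB] mult[of "[_]" "[_]"] mult[of "[_]" "[_, _]"] by (simp add: w_def comp_assoc)
  show "w x False \<circ> w x True = id"
    using eq[OF heq_cancel[of x False]] mult[of "[_]" "[_]"] one by (simp add: w_def)
  show "diffeomorphism \<A> (w x e)" by (simp add: w_def diffeo)
qed

theorem corollaryA2:
  fixes \<A> :: "('m::t2_space, 'e::real_inner) chart set"
    and g :: "('m, 'e) chart \<Rightarrow> 'm \<Rightarrow> 'e \<Rightarrow> 'e \<Rightarrow> real"
    and \<alpha> :: "heisenberg_word set \<Rightarrow> 'm \<Rightarrow> 'm"
    and h :: "'m \<Rightarrow> 'm"
  assumes "compact_riemannian_manifold \<A> g"
    and "\<alpha> \<in> hom Heisenberg (Diff \<A>)"
    and "h = \<alpha> (heisenberg_elem Gen_C)"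
  shows "topological_entropy h = 0"
proof -
  have cpt: "compact (UNIV :: 'm set)" and atlas: "smooth_atlas \<A>"
    using assms(1) by (auto simp: compact_riemannian_manifold_def)
  define w where "w x e = \<alpha> (heisenberg_class [(x, e)])" for x e
  note rel = heisenberg_action_relations[OF assms(2), of w, OF w_def]
  have h: "h = w Gen_C True" by (simp add: assms(3) heisenberg_elem_def w_def)
  define F where "F = {w Gen_A True, w Gen_A False, w Gen_B True, w Gen_B False, w Gen_C True}"
  obtain \<K> where \<K>: "compact_pieces \<A> \<K>" using compact_pieces_exist[OF cpt atlas] .
  have "finite F" "\<And>f. f \<in> F \<Longrightarrow> smooth_map \<A> f"
    using rel(5) by (auto simp: F_def diffeomorphism_def)
  then obtain L r where L: "L \<ge> 1" "r > 0" "\<And>f. f \<in> F \<Longrightarrow> stretches \<K> L r 1 f"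
    using smooth_maps_stretch[OF cpt atlas \<K>] by metis
  \<comment> \<open>A natural number whose square is at least \<open>n\<close> and which is of order \<open>sqrt n\<close>.\<close>
  define side where "side = (\<lambda>n. nat \<lfloor>sqrt (real n)\<rfloor> + 1)"
  have side: "real (side n) \<le> sqrt (real n) + 1" "sqrt (real n) \<le> real (side n)" for n
  proof -
    have "0 \<le> sqrt (real n)" by simp
    then show "real (side n) \<le> sqrt (real n) + 1" "sqrt (real n) \<le> real (side n)"
      unfolding side_def by linarith+
  qed
  show ?thesis
  proof (rule zero_entropy_of_sublinear_stretching[OF cpt atlas \<K> L(1,2)])
    have limit: "(\<lambda>n. 5 * (sqrt (real n) + 1) / real n) \<longlonglongrightarrow> 0" by real_asymp
    have upper: "real (5 * side n) / real n \<le> 5 * (sqrt (real n) + 1) / real n" for n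
      using side(1)[of n] by (intro divide_right_mono) simp_all
    show "(\<lambda>n. real (5 * side n) / real n) \<longlonglongrightarrow> 0"
      by (rule tendsto_sandwich[OF always_eventually always_eventually tendsto_const limit])
        (rule allI, simp, rule allI, rule upper)
    fix n j :: nat assume "j < n"
    have "real n \<le> real (side n * side n)"
      using mult_mono[OF side(2) side(2), of n n] by simp
    then have "j < side n * side n" using \<open>j < n\<close> by linarith
    then show "stretches \<K> L r (5 * side n) (h ^^ j)"
      unfolding h by (intro funpow_central_stretches[OF L(1) rel(1-3) rel(4) rel(4) L(3)])
        (auto simp: F_def)
  qed
qed

end
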